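(* There are absolute constants $c>0$ and $N_0\ge 1$ such that, for every infinite binary sequence $u=(u_n)_{n\ge 0}\in\{0,1\}^{\mathbb Z_{\ge 0}}$, $$L_u(N)\ge \exp\!\left(c\sqrt{\frac{\log N}{\log\log N}}\right)\qquad\text{for all integers } N\ge N_0.$$
   Context: For a binary sequence $u=(u_n)_{n\ge0}$ (each $u_n\in\{0,1\}$), define $X_0=1$ and $X_{n+1}=2X_n+u_n$ for $n\ge0$. Let $A_u$ be the set of all sums $\sum_{n\in S}X_n$ over nonempty finite sets $S\subset\mathbb Z_{\ge0}$. For an integer $N\ge1$, $L_u(N)$ is the maximum of $|P|$ over all arithmetic progressions $P\subseteq A_u\cap[1,N]$, where an arithmetic progression is a set $\{a,a+d,\ldots,a+(\ell-1)d\}$ with integer common difference $d\ge1$ and length $\ell\ge 1$. $\log$ is the natural logarithm. The constants $c,N_0$ do not depend on $u$. *)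

theory Defs
  imports Complex_Main
begin

definition binary_seq :: "(nat \<Rightarrow> nat) \<Rightarrow> bool" where
  "binary_seq u \<longleftrightarrow> (\<forall>n. u n \<in> {0, 1})"

primrec X_seq :: "(nat \<Rightarrow> nat) \<Rightarrow> nat \<Rightarrow> nat" where
  "X_seq u 0 = 1"
| "X_seq u (Suc n) = 2 * X_seq u n + u n"

definition A_set :: "(nat \<Rightarrow> nat) \<Rightarrow> nat set" where
  "A_set u = {\<Sum>n\<in>S. X_seq u n | S. finite S \<and> S \<noteq> {}}"

(* Only progressions inside [1, N] matter, so the first term is taken in nat.
   Every one-element set is a progression (l = 1). *)
definition is_AP :: "nat set \<Rightarrow> bool" where
  "is_AP P \<longleftrightarrow> (\<exists>a d l. d \<ge> 1 \<and> l \<ge> 1 \<and> P = {a + i * d | i. i < l})"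

(* For N \<ge> 1 the set under Max is finite, since every such P is a subset of {1..N}, and
   nonempty, since X_seq u 0 = 1 makes {1} admissible.  For N = 0 the value is unspecified. *)
definition L_max :: "(nat \<Rightarrow> nat) \<Rightarrow> nat \<Rightarrow> nat" where
  "L_max u N = Max {card P | P. is_AP P \<and> P \<subseteq> A_set u \<inter> {1..N}}"

end

theory Submission
  imports Defs "HOL-Library.FuncSet" "HOL-Library.Nat_Bijection" "HOL-Real_Asymp.Real_Asymp"
begin

text \<open>
  The recurrence doubles \<^term>\<open>X_seq u n\<close> up to the error \<^term>\<open>u n\<close>, and the proof looks for
  differences of subset sums in which these errors cancel. Split the indices below \<open>k * m\<close> into
  the residue classes modulo \<open>k\<close>, and for a set \<open>S\<close> of positions below \<open>m\<close> write
  \<open>P\<^sub>j(S)\<close> for the sum of \<^term>\<open>X_seq u (k * i + j)\<close> over \<open>i \<in> S\<close>. Then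
  \<open>P\<^sub>j\<^sub>+\<^sub>1(S) = 2 P\<^sub>j(S) + E\<^sub>j(S)\<close>, where \<open>E\<^sub>j(S)\<close> is the sum of \<^term>\<open>u (k * i + j)\<close> over
  \<open>i \<in> S\<close> and lies between \<open>0\<close> and \<open>m\<close>. There are \<open>2 ^ m\<close> sets \<open>S\<close> but at most
  \<open>(m + 1) ^ k\<close> vectors \<open>(E\<^sub>0(S), \<dots>, E\<^sub>k\<^sub>-\<^sub>1(S))\<close>, so if \<open>(m + 1) ^ k < 2 ^ m\<close> then two distinct
  sets \<open>S\<close> and \<open>T\<close> have the same vector (\<open>equal_column_sums\<close>), and the errors cancel
  in the differences: \<open>P\<^sub>j(S) - P\<^sub>j(T) = 2 ^ j * d\<close>, with \<open>d \<noteq> 0\<close> because distinct sets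
  of indices have distinct subset sums (\<open>subset_sums_X_inj\<close>).

  Choosing \<open>S\<close> or \<open>T\<close> independently in every residue class \<open>j < k\<close>, according to the binary
  digits of \<open>x < 2 ^ k\<close>, gives a subset sum equal to a constant plus \<open>x * d\<close>
  (\<open>subset_sum_of_digits\<close>). This is a progression of length about \<open>2 ^ k\<close> which
  uses indices below \<open>k * m\<close> only, hence lies below \<open>2 ^ (k * m + 1)\<close>. The pigeonhole
  condition allows \<open>m\<close> of order \<open>k * ln k\<close>, so \<open>ln N\<close> may be of order \<open>k\<^sup>2 * ln k\<close>, that is,
  \<open>k\<close> may be of order \<open>sqrt (ln N / ln (ln N))\<close>.
\<close>

section \<open>Subset sums of the sequence\<close>

lemma sum_X_less: "(\<Sum>i<n. X_seq u i) < X_seq u n"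
  by (induction n) auto

lemma X_less_two_power:
  assumes "binary_seq u"
  shows "X_seq u n < 2 ^ Suc n"
proof (induction n)
  case (Suc n)
  have "u n \<le> 1"
    using assms unfolding binary_seq_def by (metis insert_iff le_numeral_extra(4) singletonD zero_le_one)
  then show ?case
    using Suc by simp
qed simp

text \<open>The sequence is superincreasing, so the largest index at which two index sets differ
  decides which of the two sums is larger.\<close>
lemma subset_sums_X_inj:
  assumes "S \<subseteq> {..<n}" "T \<subseteq> {..<n}" "(\<Sum>i\<in>S. X_seq u i) = (\<Sum>i\<in>T. X_seq u i)"
  shows "S = T"
  using assms
proof (induction n arbitrary: S T)
  case (Suc n)
  have fin: "finite S" "finite T"
    using Suc.prems finite_subset by blast+
  have top: False
    if "A \<subseteq> {..<Suc n}" "B \<subseteq> {..<Suc n}" "n \<in> A" "n \<notin> B"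
      and eq: "(\<Sum>i\<in>A. X_seq u i) = (\<Sum>i\<in>B. X_seq u i)" for A B
  proof -
    have "B \<subseteq> {..<n}" "finite A"
      using that by (auto simp: less_Suc_eq intro: finite_subset)
    then have "(\<Sum>i\<in>B. X_seq u i) < X_seq u n"
      using sum_X_less[of u n] by (meson finite_lessThan le_less_trans sum_mono2 zero_le)
    also have "\<dots> \<le> (\<Sum>i\<in>A. X_seq u i)"
      using \<open>finite A\<close> \<open>n \<in> A\<close> by (simp add: member_le_sum)
    finally show False
      using eq by simp
  qed
  have iff: "n \<in> S \<longleftrightarrow> n \<in> T"
    using top[of S T] top[of T S] Suc.prems by auto
  have "(\<Sum>i\<in>S - {n}. X_seq u i) = (\<Sum>i\<in>T - {n}. X_seq u i)"
    using Suc.prems(3) iff fin by (cases "n \<in> S") (auto simp: sum.remove)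
  moreover have "S - {n} \<subseteq> {..<n}" "T - {n} \<subseteq> {..<n}"
    using Suc.prems by (auto simp: less_Suc_eq)
  ultimately have "S - {n} = T - {n}"
    using Suc.IH by blast
  then show ?case
    using iff by blast
qed simp

section \<open>Cancelling the errors by the pigeonhole principle\<close>

lemma equal_column_sums:
  fixes v :: "nat \<Rightarrow> nat \<Rightarrow> nat"
  assumes le: "\<And>i j. v i j \<le> 1" and card: "(m + 1) ^ k < 2 ^ m"
  obtains S T where "S \<subseteq> {..<m}" "T \<subseteq> {..<m}" "S \<noteq> T"
    "\<And>j. j < k \<Longrightarrow> (\<Sum>i\<in>S. v i j) = (\<Sum>i\<in>T. v i j)"
proof -
  define E where "E S = (\<lambda>j\<in>{..<k}. \<Sum>i\<in>S. v i j)" for S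
  have "(\<Sum>i\<in>S. v i j) \<le> m" if "S \<subseteq> {..<m}" for S j
  proof -
    have "(\<Sum>i\<in>S. v i j) \<le> card S * 1"
      using sum_bounded_above[of S "\<lambda>i. v i j" 1] le by simp
    also have "\<dots> \<le> m"
      using card_mono[OF _ that] by simp
    finally show ?thesis .
  qed
  then have "E ` Pow {..<m} \<subseteq> PiE {..<k} (\<lambda>_. {..m})"
    by (intro image_subsetI) (auto simp: E_def restrict_PiE_iff)
  then have "card (E ` Pow {..<m}) \<le> card (PiE {..<k} (\<lambda>_. {..m}))"
    by (intro card_mono finite_PiE) auto
  also have "\<dots> < card (Pow {..<m})"
    using card by (simp add: card_PiE card_Pow)
  finally have "\<not> inj_on E (Pow {..<m})"
    using pigeonhole by blast
  then obtain S T where ST: "S \<subseteq> {..<m}" "T \<subseteq> {..<m}" "S \<noteq> T" "E S = E T"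
    by (auto simp: inj_on_def)
  have "(\<Sum>i\<in>S. v i j) = (\<Sum>i\<in>T. v i j)" if "j < k" for j
    using fun_cong[OF ST(4), of j] that by (simp add: E_def)
  then show thesis
    using ST that by blast
qed

text \<open>Equal error sums make the difference of the two sums double exactly when \<open>j\<close> grows by one.
  The difference at \<open>j = 0\<close> is nonzero, since it compares subset sums over distinct sets of multiples
  of \<open>k\<close>, and it can be taken positive, since the two sets may be swapped.\<close>
lemma doubling_differences:
  assumes u: "binary_seq u" and card: "(m + 1) ^ k < 2 ^ m" and k: "k \<ge> 1"
  obtains S T d where "S \<subseteq> {..<m}" "T \<subseteq> {..<m}" "d \<ge> 1"
    "\<And>j. j < k \<Longrightarrow>
      (\<Sum>i\<in>S. X_seq u (k * i + j)) = (\<Sum>i\<in>T. X_seq u (k * i + j)) + 2 ^ j * d"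
proof -
  define P where "P S j = (\<Sum>i\<in>S. X_seq u (k * i + j))" for S j
  have "u (k * i + j) \<le> 1" for i j
    using u unfolding binary_seq_def by (metis insert_iff le_numeral_extra(4) singletonD zero_le_one)
  then obtain S T where ST: "S \<subseteq> {..<m}" "T \<subseteq> {..<m}" "S \<noteq> T"
    and E: "\<And>j. j < k \<Longrightarrow> (\<Sum>i\<in>S. u (k * i + j)) = (\<Sum>i\<in>T. u (k * i + j))"
    using equal_column_sums[of "\<lambda>i j. u (k * i + j)" m k] card by blast
  have step: "P A (Suc j) = 2 * P A j + (\<Sum>i\<in>A. u (k * i + j))" for A j
    by (simp add: P_def sum.distrib sum_distrib_left)
  have doubling: "P A j = P B j + 2 ^ j * d"
    if "P A 0 = P B 0 + d" "\<And>j. j < k \<Longrightarrow> (\<Sum>i\<in>A. u (k * i + j)) = (\<Sum>i\<in>B. u (k * i + j))"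
      "j < k" for A B d j
    using that(3)
  proof (induction j)
    case (Suc j)
    then show ?case
      using that(2)[of j] by (simp add: step)
  qed (simp add: that(1))
  have "P S 0 \<noteq> P T 0"
  proof
    have inj: "inj_on (\<lambda>i. k * i) A" for A
      using k by (auto simp: inj_on_def)
    assume "P S 0 = P T 0"
    then have "(\<Sum>i\<in>(*) k ` S. X_seq u i) = (\<Sum>i\<in>(*) k ` T. X_seq u i)"
      by (simp add: P_def sum.reindex[OF inj] o_def)
    moreover have "(*) k ` S \<subseteq> {..<k * m}" "(*) k ` T \<subseteq> {..<k * m}"
      using ST k by auto
    ultimately have "(*) k ` S = (*) k ` T"
      by (intro subset_sums_X_inj)
    then show False
      using ST(3) inj[of UNIV] by (simp add: inj_image_eq_iff)
  qed
  then consider "P T 0 < P S 0" | "P S 0 < P T 0"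
    by linarith
  then show thesis
  proof cases
    case 1
    then have "P S 0 = P T 0 + (P S 0 - P T 0)"
      by simp
    from doubling[OF this E] show thesis
      using that[of S T "P S 0 - P T 0"] ST 1 by (simp add: P_def)
  next
    case 2
    then have "P T 0 = P S 0 + (P T 0 - P S 0)"
      by simp
    from doubling[OF this E[symmetric]] show thesis
      using that[of T S "P T 0 - P S 0"] ST 2 by (simp add: P_def)
  qed
qed

section \<open>The progression\<close>

text \<open>Indices from different residue classes modulo \<open>k\<close> never collide, so a choice of one set of
  positions per class is a single set of indices.\<close>
lemma sum_residue_classes:
  fixes f :: "nat \<Rightarrow> nat" and C :: "nat \<Rightarrow> nat set"
  assumes "\<And>j. j < k \<Longrightarrow> C j \<subseteq> {..<m}"
  obtains I where "I \<subseteq> {..<k * m}" "(\<Sum>n\<in>I. f n) = (\<Sum>j<k. \<Sum>i\<in>C j. f (k * i + j))"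
proof
  define g where "g = (\<lambda>(j, i). k * i + j :: nat)"
  have inj: "inj_on g (Sigma {..<k} C)"
  proof (rule inj_onI, clarsimp simp: g_def)
    fix j i j' i' :: nat
    assume "j < k" "j' < k" and eq: "k * i + j = k * i' + j'"
    have "(k * i + j) mod k = j" "(k * i' + j') mod k = j'"
      using \<open>j < k\<close> \<open>j' < k\<close> by simp_all
    then show "j = j' \<and> i = i'"
      using eq \<open>j < k\<close> by simp
  qed
  have fin: "\<forall>j\<in>{..<k}. finite (C j)"
    using assms finite_subset by blast
  have "k * i + j < k * m" if "j < k" "i \<in> C j" for i j
  proof -
    have "k * i + j < k * Suc i"
      using that by simp
    also have "\<dots> \<le> k * m"
      using assms[OF that(1)] that(2) by (intro mult_le_mono2) auto
    finally show ?thesis .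
  qed
  then show "g ` Sigma {..<k} C \<subseteq> {..<k * m}"
    by (auto simp: g_def)
  show "(\<Sum>n\<in>g ` Sigma {..<k} C. f n) = (\<Sum>j<k. \<Sum>i\<in>C j. f (k * i + j))"
    using fin by (subst sum.reindex[OF inj]) (simp add: sum.Sigma g_def case_prod_unfold)
qed

lemma sum_set_decode:
  assumes "x < 2 ^ k"
  shows "(\<Sum>j<k. if j \<in> set_decode x then 2 ^ j else 0) = x"
proof -
  have "j < k" if "j \<in> set_decode x" for j
  proof (rule ccontr)
    assume "\<not> j < k"
    then have "x < 2 ^ j"
      using assms by (meson linorder_not_less less_le_trans one_le_numeral power_increasing)
    then show False
      using that by (simp add: set_decode_def)
  qed
  then have "{..<k} \<inter> set_decode x = set_decode x"
    by auto
  then show ?thesis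
    using set_decode_inverse[of x] by (simp add: sum.If_cases set_encode_def)
qed

lemma subset_sum_of_digits:
  assumes ST: "S \<subseteq> {..<m}" "T \<subseteq> {..<m}"
    and diff: "\<And>j. j < k \<Longrightarrow> (\<Sum>i\<in>S. f (k * i + j)) = (\<Sum>i\<in>T. f (k * i + j)) + 2 ^ j * d"
    and x: "x < 2 ^ k"
  obtains I where "I \<subseteq> {..<k * m}"
    "(\<Sum>n\<in>I. f n) = (\<Sum>j<k. \<Sum>i\<in>T. f (k * i + j)) + x * (d::nat)"
proof -
  define C where "C j = (if j \<in> set_decode x then S else T)" for j
  have "(\<Sum>i\<in>C j. f (k * i + j)) =
      (\<Sum>i\<in>T. f (k * i + j)) + (if j \<in> set_decode x then 2 ^ j else 0) * d" if "j < k" for j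
    using diff[OF that] by (simp add: C_def)
  then have "(\<Sum>j<k. \<Sum>i\<in>C j. f (k * i + j)) =
      (\<Sum>j<k. (\<Sum>i\<in>T. f (k * i + j)) + (if j \<in> set_decode x then 2 ^ j else 0) * d)"
    by (intro sum.cong) auto
  also have "\<dots> = (\<Sum>j<k. \<Sum>i\<in>T. f (k * i + j)) + x * d"
    by (simp only: sum.distrib sum_distrib_right[symmetric] sum_set_decode[OF x])
  finally have "(\<Sum>j<k. \<Sum>i\<in>C j. f (k * i + j)) = \<dots>" .
  moreover obtain I where "I \<subseteq> {..<k * m}"
    "(\<Sum>n\<in>I. f n) = (\<Sum>j<k. \<Sum>i\<in>C j. f (k * i + j))"
  proof (rule sum_residue_classes)
    show "C j \<subseteq> {..<m}" for j
      using ST by (simp add: C_def)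
  qed
  ultimately show thesis
    using that by simp
qed

lemma card_AP:
  fixes a d l :: nat
  assumes "d \<ge> 1"
  shows "card {a + i * d | i. i < l} = l"
proof -
  have "{a + i * d | i. i < l} = (\<lambda>i. a + i * d) ` {..<l}"
    by auto
  moreover have "inj_on (\<lambda>i. a + i * d) {..<l}"
    using assms by (auto simp: inj_on_def)
  ultimately show ?thesis
    by (simp add: card_image)
qed

lemma AP_le_L_max:
  assumes "d \<ge> 1" "l \<ge> 1" "\<And>i. i < l \<Longrightarrow> a + i * d \<in> A_set u \<inter> {1..N}"
  shows "l \<le> L_max u N"
  unfolding L_max_def
proof (rule Max_ge)
  have "{card P | P. is_AP P \<and> P \<subseteq> A_set u \<inter> {1..N}} \<subseteq> card ` Pow {1..N}"
    by auto
  then show "finite {card P | P. is_AP P \<and> P \<subseteq> A_set u \<inter> {1..N}}"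
    by (rule finite_subset) simp
  have "is_AP {a + i * d | i. i < l}"
    using assms(1,2) unfolding is_AP_def by blast
  moreover have "{a + i * d | i. i < l} \<subseteq> A_set u \<inter> {1..N}"
    using assms(3) by auto
  ultimately show "l \<in> {card P | P. is_AP P \<and> P \<subseteq> A_set u \<inter> {1..N}}"
    using card_AP[OF assms(1), of a l] by (metis (mono_tags, lifting) mem_Collect_eq)
qed

text \<open>The length is \<open>2 ^ k - 1\<close> rather than \<open>2 ^ k\<close>: the choice \<open>x = 0\<close> is left out because it
  takes \<open>T\<close> in every residue class, and \<open>T\<close> may be empty, whereas \<^term>\<open>A_set u\<close> only has sums
  over nonempty sets.\<close>
lemma L_max_ge_two_power:
  assumes u: "binary_seq u" and card: "(m + 1) ^ k < 2 ^ m" and k: "k \<ge> 1"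
    and N: "2 ^ (k * m + 1) \<le> N"
  shows "2 ^ k - 1 \<le> L_max u N"
proof -
  obtain S T d where ST: "S \<subseteq> {..<m}" "T \<subseteq> {..<m}" and d: "d \<ge> 1"
    and diff: "\<And>j. j < k \<Longrightarrow>
      (\<Sum>i\<in>S. X_seq u (k * i + j)) = (\<Sum>i\<in>T. X_seq u (k * i + j)) + 2 ^ j * d"
    using doubling_differences[OF u card k] by blast
  define c where "c = (\<Sum>j<k. \<Sum>i\<in>T. X_seq u (k * i + j))"
  show ?thesis
  proof (rule AP_le_L_max[where a = "c + d" and d = d])
    show "1 \<le> (2::nat) ^ k - 1"
      using power_increasing[OF k, of "2::nat"] by simp
    fix i :: nat
    assume "i < 2 ^ k - 1"
    then have "Suc i < 2 ^ k"
      by simp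
    then obtain I where I: "I \<subseteq> {..<k * m}" "(\<Sum>n\<in>I. X_seq u n) = c + Suc i * d"
      using subset_sum_of_digits[of S m T k "X_seq u" d "Suc i"] ST diff unfolding c_def by blast
    have "finite I"
      using I(1) finite_subset by blast
    moreover have "I \<noteq> {}"
      using I(2) d by auto
    ultimately have "c + Suc i * d \<in> A_set u"
      unfolding A_set_def using I(2)[symmetric] by blast
    moreover have "c + Suc i * d \<le> N"
    proof -
      have "c + Suc i * d \<le> (\<Sum>n<k * m. X_seq u n)"
        unfolding I(2)[symmetric] using I(1) by (intro sum_mono2) auto
      also have "\<dots> < X_seq u (k * m)"
        by (rule sum_X_less)
      also have "\<dots> < 2 ^ (k * m + 1)"
        using X_less_two_power[OF u, of "k * m"] by simp
      finally show ?thesis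
        using N by simp
    qed
    ultimately show "(c + d) + i * d \<in> A_set u \<inter> {1..N}"
      using d by (simp add: algebra_simps)
  qed (rule d)
qed

section \<open>The choice of the parameters\<close>

text \<open>With \<open>y = ln N\<close>, the choice is \<open>k\<close> about \<open>sqrt (y / ln y) / 4\<close> and \<open>m\<close> about
  \<open>sqrt (y * ln y)\<close>. Then \<open>k * m\<close> is about \<open>y / 4\<close>, which keeps the progression below \<open>N\<close>, and
  \<open>k * ln (m + 1)\<close> is at most \<open>k * ln y\<close>, hence at most \<open>sqrt (y * ln y) / 4\<close>, which is less than
  \<open>m * ln 2\<close>. The bound \<open>ln 2 \<ge> 1 / 2\<close> turns \<open>2 ^ k\<close> into \<open>exp (sqrt (y / ln y) / 8)\<close> up to a
  constant factor, and any constant below \<open>1 / 8\<close>, here \<open>1 / 10\<close>, absorbs the losses for large \<open>y\<close>.\<close>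
lemma parameter_choice:
  "\<forall>\<^sub>F y::real in at_top. \<exists>k m. k \<ge> 1 \<and> (m + 1) ^ k < (2::nat) ^ m \<and> 2 ^ (k * m + 1) \<le> exp y \<and>
     exp (sqrt (y / ln y) / 10) \<le> 2 ^ k - 1"
proof -
  have "\<forall>\<^sub>F y::real in at_top. sqrt (y / ln y) / 4 \<ge> 1"
    by real_asymp
  moreover have "\<forall>\<^sub>F y::real in at_top. sqrt (y * ln y) > 2"
    by real_asymp
  moreover have "\<forall>\<^sub>F y::real in at_top. sqrt (y * ln y) + 1 \<le> y"
    by real_asymp
  moreover have "\<forall>\<^sub>F y::real in at_top. ln y > 0"
    by real_asymp
  moreover have "\<forall>\<^sub>F y::real in at_top.
      exp (sqrt (y / ln y) / 10) \<le> exp ((sqrt (y / ln y) / 4 - 1) / 2) - 1"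
    by real_asymp
  ultimately show ?thesis
  proof eventually_elim
    case (elim y)
    define r where "r = sqrt (y / ln y) / 4"
    define t where "t = sqrt (y * ln y)"
    have r: "1 \<le> r" and t: "2 < t" "t + 1 \<le> y"
      using elim by (simp_all add: r_def t_def)
    have y: "y > 0"
      using t by simp
    have "sqrt (y / ln y) * ln y = sqrt y * (ln y / sqrt (ln y))"
      by (simp add: real_sqrt_divide)
    also have "\<dots> = t"
      using elim(4) by (simp only: real_div_sqrt less_imp_le t_def real_sqrt_mult)
    finally have r_ln: "r * ln y = t / 4"
      by (simp add: r_def)
    have r_t: "r * t = y / 4"
      using y elim(4) by (simp add: r_def t_def real_sqrt_divide real_sqrt_mult)
    have ln2: "1 / 2 \<le> ln (2::real)" "ln (2::real) \<le> 1"
      using ln_le_minus_one[of "1 / 2 :: real"] ln_le_minus_one[of "2 :: real"] by (simp_all add: ln_div)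
    define k where "k = nat \<lfloor>r\<rfloor>"
    define m where "m = nat \<lfloor>t\<rfloor>"
    have k: "real k \<le> r" "r - 1 < real k" "k \<ge> 1"
      using r unfolding k_def by linarith+
    have m: "real m \<le> t" "t - 1 < real m"
      using t(1) unfolding m_def by linarith+
    have two_power: "(2::real) ^ n = exp (real n * ln 2)" for n
      by (simp add: exp_of_nat_mult)
    have "real k * ln (real m + 1) \<le> r * ln y"
      using k m r t y by (intro mult_mono ln_mono) auto
    also have "\<dots> < (t - 1) * (1 / 2)"
      unfolding r_ln using t by simp
    also have "\<dots> \<le> real m * ln 2"
      using m t ln2 by (intro mult_mono) auto
    finally have "exp (real k * ln (real m + 1)) < 2 ^ m"
      by (simp add: two_power)
    then have "(real m + 1) ^ k < 2 ^ m"
      by (simp add: exp_of_nat_mult)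
    then have "real ((m + 1) ^ k) < real (2 ^ m)"
      by (simp add: add.commute)
    then have 1: "(m + 1) ^ k < 2 ^ m"
      using of_nat_less_iff by blast
    have "real (k * m + 1) * ln 2 \<le> (r * t + 1) * 1"
      using k m r t ln2 by (intro mult_mono) (auto intro!: mult_mono)
    also have "\<dots> \<le> y"
      unfolding r_t using t by simp
    finally have 2: "(2::real) ^ (k * m + 1) \<le> exp y"
      by (subst two_power) simp
    have "exp (sqrt (y / ln y) / 10) \<le> exp ((r - 1) * (1 / 2)) - 1"
      using elim(5) by (simp add: r_def)
    also have "(r - 1) * (1 / 2) \<le> real k * ln 2"
      using k r ln2 by (intro mult_mono) auto
    also have "exp (real k * ln 2) = 2 ^ k"
      by (rule two_power[symmetric])
    finally have 3: "exp (sqrt (y / ln y) / 10) \<le> 2 ^ k - 1"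
      by simp
    show ?case
      using k(3) 1 2 3 by blast
  qed
qed

theorem theorem1p1:
  shows "\<exists>c::real. \<exists>N0::nat. c > 0 \<and> N0 \<ge> 1 \<and>
    (\<forall>u. binary_seq u \<longrightarrow>
      (\<forall>N\<ge>N0. real (L_max u N) \<ge> exp (c * sqrt (ln (real N) / ln (ln (real N))))))"
proof -
  have "filterlim (\<lambda>N::nat. ln (real N)) at_top sequentially"
    by real_asymp
  from eventually_compose_filterlim[OF parameter_choice this]
  obtain N1 where N1: "\<And>N. N \<ge> N1 \<Longrightarrow> \<exists>k m. k \<ge> 1 \<and> (m + 1) ^ k < (2::nat) ^ m \<and>
      2 ^ (k * m + 1) \<le> exp (ln (real N)) \<and>
      exp (sqrt (ln (real N) / ln (ln (real N))) / 10) \<le> 2 ^ k - 1"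
    unfolding eventually_sequentially by blast
  have "exp (1 / 10 * sqrt (ln (real N) / ln (ln (real N)))) \<le> real (L_max u N)"
    if u: "binary_seq u" and N: "N \<ge> max 1 N1" for u N
  proof -
    obtain k m where k: "k \<ge> 1" and card: "(m + 1) ^ k < (2::nat) ^ m"
      and le: "2 ^ (k * m + 1) \<le> exp (ln (real N))"
      and len: "exp (sqrt (ln (real N) / ln (ln (real N))) / 10) \<le> 2 ^ k - 1"
      using N1[of N] N by auto
    have "real (2 ^ (k * m + 1)) \<le> real N"
      using le N by simp
    then have "2 ^ k - 1 \<le> L_max u N"
      using of_nat_le_iff by (intro L_max_ge_two_power[OF u card k]) blast
    then have "real (2 ^ k - 1) \<le> real (L_max u N)"
      by (rule of_nat_mono)
    moreover have "real (2 ^ k - 1) = 2 ^ k - 1"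
      by (subst of_nat_diff) simp_all
    ultimately show ?thesis
      using len by simp
  qed
  then show ?thesis
    by (intro exI[of _ "1 / 10"] exI[of _ "max 1 N1"]) auto
qed

end
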